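(* Let $n$ be a positive integer and let $G$ be a finite simple graph with chromatic number $\chi(G)=n$. Then for every coloring of the edges of $G$ with $2$ colors, there is a monochromatic tree on $n$ vertices in $G$ (that is, a subtree of $G$ with $n$ vertices all of whose edges receive the same color).
   Context: The chromatic number $\chi(G)$ of a graph $G$ is the minimum number $m$ such that the vertices of $G$ can be colored with $m$ colors so that no two adjacent vertices receive the same color. Edge colorings are arbitrary (not necessarily proper). *)

theory Defs
  imports "Graph_Theory.Graph_Theory"
begin

text \<open>
  A finite simple graph is a \<^locale>\<open>pair_graph\<close>: finitely many vertices and a finite, symmetric,
  loop-free set of ordered pairs of vertices. An undirected edge is thus represented by the two arcs
  \<open>(u, v)\<close> and \<open>(v, u)\<close>; the unordered edge behind them is the set \<open>{u, v}\<close>.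
\<close>

definition uedges :: "'a pair_pre_digraph \<Rightarrow> 'a set set" where
  "uedges G = (\<lambda>(u, v). {u, v}) ` parcs G"

definition proper_coloring :: "'a pair_pre_digraph \<Rightarrow> nat \<Rightarrow> ('a \<Rightarrow> nat) \<Rightarrow> bool" where
  "proper_coloring G k f \<longleftrightarrow>
     f ` pverts G \<subseteq> {..<k} \<and> (\<forall>(u, v) \<in> parcs G. f u \<noteq> f v)"

definition chromatic_number :: "'a pair_pre_digraph \<Rightarrow> nat" where
  "chromatic_number G = (LEAST k. \<exists>f. proper_coloring G k f)"

definition edge_coloring :: "'a pair_pre_digraph \<Rightarrow> nat \<Rightarrow> ('a set \<Rightarrow> nat) \<Rightarrow> bool" where
  "edge_coloring G k c \<longleftrightarrow> c ` uedges G \<subseteq> {..<k}"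

definition monochromatic :: "('a set \<Rightarrow> nat) \<Rightarrow> 'a pair_pre_digraph \<Rightarrow> bool" where
  "monochromatic c H \<longleftrightarrow> (\<exists>i. \<forall>e \<in> uedges H. c e = i)"

text \<open>
  The constant \<^const>\<open>tree\<close> forbids every directed cycle, in particular the closed walk of length 2
  that runs back and forth along one undirected edge, so it does not describe undirected trees. In a
  symmetric loop-free digraph without parallel arcs, the directed cycles of length at least 3 are
  exactly the traversals of undirected cycles. Connected graphs are nonempty by definition.
\<close>

definition undirected_tree :: "'a pair_pre_digraph \<Rightarrow> bool" where
  "undirected_tree T \<longleftrightarrow>
     pair_graph T \<and> connected (with_proj T) \<and>
     \<not> (\<exists>p. pre_digraph.cycle (with_proj T) p \<and> 3 \<le> length p)"

end

theory Submission
  imports Defs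
begin

text \<open>
  Suppose that no monochromatic component has \<open>n\<close> or more vertices. Let \<open>H\<close> be the bipartite
  multigraph whose nodes are the components of color \<open>0\<close> on one side and those of color \<open>1\<close> on the
  other, and in which every vertex of \<open>G\<close> is an edge joining the two components that contain it.
  The maximum degree of \<open>H\<close> is at most \<open>n - 1\<close>, so Koenig's theorem colors the edges of \<open>H\<close>
  properly with \<open>n - 1\<close> colors. Adjacent vertices of \<open>G\<close> share a component, so this is a proper
  coloring of \<open>G\<close> with too few colors. Hence some monochromatic component has at least \<open>n\<close> vertices,
  and a tree on \<open>n\<close> vertices is grown inside it leaf by leaf.
\<close>

section \<open>Edge colorings of bipartite multigraphs\<close>

text \<open>
  The elements of \<open>V\<close> are the edges of the multigraph; \<open>r v\<close> and \<open>s v\<close> are the two ends of \<open>v\<close>.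
\<close>

definition konig_coloring :: "'v set \<Rightarrow> ('v \<Rightarrow> 'r) \<Rightarrow> ('v \<Rightarrow> 's) \<Rightarrow> nat \<Rightarrow> ('v \<Rightarrow> nat) \<Rightarrow> bool" where
  "konig_coloring V r s d f \<longleftrightarrow> f ` V \<subseteq> {..<d} \<and>
     (\<forall>u\<in>V. \<forall>v\<in>V. u \<noteq> v \<longrightarrow> r u = r v \<or> s u = s v \<longrightarrow> f u \<noteq> f v)"

text \<open>
  Swapping the colors \<open>\<alpha>\<close> and \<open>\<beta>\<close> along the alternating path that starts at \<open>y\<close> frees \<open>\<alpha>\<close> at \<open>y\<close>.
  The path enters nodes on the \<open>r\<close> side through \<open>\<alpha>\<close>, hence avoids \<open>x\<close>, where \<open>\<alpha>\<close> stays free.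
\<close>

lemma kempe_swap:
  assumes f: "konig_coloring V r s d f" and ab: "\<alpha> < d" "\<beta> < d"
    and x: "\<forall>u\<in>V. r u = x \<longrightarrow> f u \<noteq> \<alpha>" and y: "\<forall>u\<in>V. s u = y \<longrightarrow> f u \<noteq> \<beta>"
  obtains g where "konig_coloring V r s d g"
    "\<forall>u\<in>V. r u = x \<or> s u = y \<longrightarrow> g u \<noteq> \<alpha>"
proof (cases "\<alpha> = \<beta>")
  case True
  with f x y show ?thesis by (intro that) auto
next
  case False
  \<comment> \<open>The alternating paths are directed: at an \<open>r\<close> node they pass from
    color \<open>\<alpha>\<close> to \<open>\<beta>\<close>, at an \<open>s\<close> node from
    \<open>\<beta>\<close> back to \<open>\<alpha>\<close>.\<close>
  define E where "E = {(u, w). u \<in> V \<and> w \<in> V \<and>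
    (f u = \<alpha> \<and> f w = \<beta> \<and> r u = r w \<or> f u = \<beta> \<and> f w = \<alpha> \<and> s u = s w)}"
  \<comment> \<open>Properness allows at most one edge of color \<open>\<alpha>\<close> at
    \<open>y\<close>, so \<open>C\<close> is a single path, or empty if \<open>\<alpha>\<close> is
    already free there.\<close>
  define C where "C = E\<^sup>* `` {u \<in> V. f u = \<alpha> \<and> s u = y}"
  define g where "g u = (if u \<in> C then (if f u = \<alpha> then \<beta> else \<alpha>) else f u)" for u
  have proper: "u = v" if "u \<in> V" "v \<in> V" "r u = r v \<or> s u = s v" "f u = f v" for u v
    using f that unfolding konig_coloring_def by blast
  have cases: "(w \<in> V \<and> f w = \<alpha> \<and> s w = y) \<or> (\<exists>u\<in>C. (u, w) \<in> E)" if "w \<in> C" for w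
    using that unfolding C_def by (auto elim: rtranclE)
  have C: "w \<in> V \<and> (f w = \<alpha> \<or> f w = \<beta>)" if "w \<in> C" for w
    using cases[OF that] unfolding E_def by auto
  have fwd: "w \<in> C" if "u \<in> C" "(u, w) \<in> E" for u w
    using that unfolding C_def by (auto intro: rtrancl_into_rtrancl)
  \<comment> \<open>Predecessors under \<open>E\<close> are unique by properness, and the first edge
    has none because \<open>\<beta>\<close> is free at \<open>y\<close>. So \<open>C\<close> is
    closed backwards as well as forwards.\<close>
  have bwd: "u \<in> C" if wC: "w \<in> C" and uw: "(u, w) \<in> E" for u w
    using cases[OF wC]
  proof
    assume w: "w \<in> V \<and> f w = \<alpha> \<and> s w = y"
    then have False using uw False y unfolding E_def by auto
    then show ?thesis ..
  next
    assume "\<exists>u\<in>C. (u, w) \<in> E"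
    then obtain u' where u': "u' \<in> C" "(u', w) \<in> E" by blast
    have "u \<in> V" "u' \<in> V" "r u = r u' \<or> s u = s u'" "f u = f u'"
      using uw u'(2) False unfolding E_def by auto
    then have "u = u'" by (rule proper)
    with u' show ?thesis by simp
  qed
  have E_iff: "u \<in> C \<longleftrightarrow> w \<in> C"
    if "u \<in> V" "w \<in> V" "r u = r w \<or> s u = s w" "f u = \<alpha>" "f w = \<beta>" for u w
  proof -
    have "(u, w) \<in> E \<or> (w, u) \<in> E" using that unfolding E_def by auto
    then show ?thesis using fwd bwd by blast
  qed
  have "konig_coloring V r s d g"
    unfolding konig_coloring_def
  proof (intro conjI ballI impI)
    show "g ` V \<subseteq> {..<d}"
      using f ab unfolding konig_coloring_def g_def by auto
  next
    fix u v assume uv: "u \<in> V" "v \<in> V" "u \<noteq> v" "r u = r v \<or> s u = s v"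
    then have ne: "f u \<noteq> f v" using proper by blast
    show "g u \<noteq> g v"
      using ne C[of u] C[of v] E_iff[of u v] E_iff[of v u] uv False
      unfolding g_def by (auto split: if_splits)
  qed
  moreover have "g u \<noteq> \<alpha>" if u: "u \<in> V" "r u = x \<or> s u = y" for u
  proof
    assume g: "g u = \<alpha>"
    show False
    proof (cases "u \<in> C")
      case True
      with g False C have fu: "f u = \<beta>" unfolding g_def by (auto split: if_splits)
      with u y have "r u = x" by auto
      \<comment> \<open>Color \<open>\<beta>\<close> is entered only through an \<open>r\<close>
        node, here \<open>x\<close>, from an edge of color \<open>\<alpha>\<close>; but
        \<open>\<alpha>\<close> is free at \<open>x\<close>.\<close>
      moreover from cases[OF True] fu False obtain v where "(v, u) \<in> E" by auto
      ultimately show False using x fu False unfolding E_def by auto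
    next
      case uC: False
      with g have fu: "f u = \<alpha>" unfolding g_def by simp
      with u x have "s u = y" by auto
      with u fu have "u \<in> C" unfolding C_def by auto
      with uC show False ..
    qed
  qed
  ultimately show ?thesis using that by blast
qed

text \<open>The edges are inserted one at a time. A new edge has a free color at each end, and a
  Kempe swap makes one color free at both.\<close>

theorem konig_edge_coloring:
  assumes "finite V"
    and "\<And>x. card {v \<in> V. r v = x} \<le> d" "\<And>y. card {v \<in> V. s v = y} \<le> d"
  shows "\<exists>f. konig_coloring V r s d f"
  using assms
proof (induction V rule: finite_induct)
  case empty
  show ?case by (simp add: konig_coloring_def)
next
  case (insert a V)
  have le: "card {v \<in> V. p v} \<le> card {v \<in> insert a V. p v}" for p
    by (rule card_mono) (use insert.hyps in auto)
  obtain f where f: "konig_coloring V r s d f"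
    using insert.IH[OF order_trans[OF le insert.prems(1)] order_trans[OF le insert.prems(2)]]
    by blast
  \<comment> \<open>The edge \<open>a\<close> counts toward the degree at its ends but is not
    colored yet, so fewer than \<open>d\<close> colors occur there.\<close>
  have free: "\<exists>\<alpha><d. \<forall>u\<in>V. p u \<longrightarrow> f u \<noteq> \<alpha>"
    if "p a" "card {v \<in> insert a V. p v} \<le> d" for p
  proof -
    have "{v \<in> insert a V. p v} = insert a {v \<in> V. p v}" using that by auto
    then have "card {v \<in> V. p v} < d" using that insert.hyps by simp
    moreover have "card (f ` {v \<in> V. p v}) \<le> card {v \<in> V. p v}"
      using insert.hyps by (intro card_image_le) auto
    ultimately have "\<not> {..<d} \<subseteq> f ` {v \<in> V. p v}"
      using card_mono[of "f ` {v \<in> V. p v}" "{..<d}"] insert.hyps by auto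
    then show ?thesis by blast
  qed
  obtain \<alpha> where \<alpha>: "\<alpha> < d" "\<forall>u\<in>V. r u = r a \<longrightarrow> f u \<noteq> \<alpha>"
    using free[of "\<lambda>v. r v = r a"] insert.prems by auto
  obtain \<beta> where \<beta>: "\<beta> < d" "\<forall>u\<in>V. s u = s a \<longrightarrow> f u \<noteq> \<beta>"
    using free[of "\<lambda>v. s v = s a"] insert.prems by auto
  obtain g where g: "konig_coloring V r s d g"
    "\<forall>u\<in>V. r u = r a \<or> s u = s a \<longrightarrow> g u \<noteq> \<alpha>"
    using kempe_swap[OF f \<alpha>(1) \<beta>(1) \<alpha>(2) \<beta>(2)] .
  have "konig_coloring (insert a V) r s d (g(a := \<alpha>))"
    using g \<alpha>(1) insert.hyps unfolding konig_coloring_def by (auto simp: eq_commute)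
  then show ?case by blast
qed

section \<open>Growing trees\<close>

lemma mk_symmetric_with_proj:
  assumes "sym (parcs T)"
  shows "mk_symmetric (with_proj T) = T"
proof -
  have "parcs (mk_symmetric (with_proj T)) = parcs T"
    using assms by (auto simp: parcs_mk_symmetric sym_def)
  then show ?thesis by (simp add: mk_symmetric_def)
qed

text \<open>The arcs are already symmetric, so the symmetrization inside \<open>connected\<close>
  changes nothing and reachability is plain \<open>rtrancl\<close>.\<close>

lemma connected_with_proj:
  assumes "pair_graph T"
  shows "connected (with_proj T) \<longleftrightarrow> pverts T \<noteq> {} \<and> pverts T \<times> pverts T \<subseteq> (parcs T)\<^sup>*"
proof -
  interpret pair_graph T by fact
  have "sym (parcs T)" using sym_arcs by (simp add: symmetric_def)
  then show ?thesis
    by (auto simp: connected_def mk_symmetric_with_proj strongly_connected_def reachable_conv)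
qed

lemma pcas_nth:
  assumes "pcas u p v" "p \<noteq> []"
  shows "fst (p ! 0) = u" "snd (p ! (length p - 1)) = v"
    "\<And>i. Suc i < length p \<Longrightarrow> fst (p ! Suc i) = snd (p ! i)"
proof -
  have "fst (p ! 0) = u \<and> snd (p ! (length p - 1)) = v \<and>
     (\<forall>i. Suc i < length p \<longrightarrow> fst (p ! Suc i) = snd (p ! i))"
    using assms
  proof (induction p arbitrary: u)
    case (Cons e p)
    show ?case
    proof (cases "p = []")
      case False
      with Cons.prems have IH: "fst (p ! 0) = snd e" "snd (p ! (length p - 1)) = v"
        "\<forall>i. Suc i < length p \<longrightarrow> fst (p ! Suc i) = snd (p ! i)"
        using Cons.IH[of "snd e"] by auto
      then have "fst ((e # p) ! Suc i) = snd ((e # p) ! i)" if "Suc i < length (e # p)" for i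
        using that by (cases i) auto
      then show ?thesis using IH Cons.prems False by (auto simp: nth_Cons')
    qed (use Cons in auto)
  qed simp
  then show "fst (p ! 0) = u" "snd (p ! (length p - 1)) = v"
    "\<And>i. Suc i < length p \<Longrightarrow> fst (p ! Suc i) = snd (p ! i)"
    by auto
qed

text \<open>This is what rules out a leaf on a cycle: the vertices just before and just after
  \<open>w\<close> are heads of two different arcs, hence distinct.\<close>

lemma closed_walk_neighbors:
  assumes cas: "pcas u p u" and dist: "distinct (map snd p)" and len: "3 \<le> length p"
    and w: "w \<in> snd ` set p"
  obtains a b where "(a, w) \<in> set p" "(w, b) \<in> set p" "a \<noteq> b"
proof -
  from w obtain i where i: "i < length p" "snd (p ! i) = w"
    by (auto simp: in_set_conv_nth)
  have ne: "p \<noteq> []" using len by auto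
  note nth = pcas_nth[OF cas ne]
  \<comment> \<open>\<open>j\<close> and \<open>k\<close> are the cyclic successor and predecessor
    of \<open>i\<close>; they would coincide for length 2.\<close>
  define j where "j = (if Suc i = length p then 0 else Suc i)"
  define k where "k = (if i = 0 then length p - 1 else i - 1)"
  have bounds: "j < length p" "k < length p" and "j \<noteq> k"
    using i len unfolding j_def k_def by auto
  then have "snd (p ! k) \<noteq> snd (p ! j)"
    using dist nth_eq_iff_index_eq[of "map snd p" k j] by auto
  moreover have "fst (p ! j) = w"
  proof (cases "Suc i = length p")
    case True
    then have "i = length p - 1" by simp
    then show ?thesis using nth(1,2) i True unfolding j_def by simp
  next
    case False
    then show ?thesis using nth(3)[of i] i unfolding j_def by simp
  qed
  moreover have "fst (p ! i) = snd (p ! k)"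
    using nth(1,2) nth(3)[of "i - 1"] i unfolding k_def by (auto split: if_splits)
  ultimately show ?thesis
    using that[of "snd (p ! k)" "snd (p ! j)"] i bounds nth_mem by (metis prod.collapse)
qed

lemma undirected_tree_single:
  "undirected_tree \<lparr>pverts = {a}, parcs = {}\<rparr>" (is "undirected_tree ?T")
proof -
  interpret pair_graph ?T by unfold_locales (auto simp: symmetric_def sym_def)
  have "\<not> cycle p" for p by (auto simp: cycle_def awalk_def)
  then show ?thesis
    unfolding undirected_tree_def
    using connected_with_proj[OF pair_graph] pair_graph by auto
qed

text \<open>All connections can be routed through \<open>u\<close>. A cycle of length at least 3
  through \<open>w\<close> would need two distinct neighbors of \<open>w\<close>, and one that
  avoids \<open>w\<close> already lies in \<open>T\<close>.\<close>

lemma undirected_tree_insert_leaf: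
  assumes T: "undirected_tree T" and u: "u \<in> pverts T" and w: "w \<notin> pverts T"
  defines "T' \<equiv> \<lparr>pverts = insert w (pverts T), parcs = parcs T \<union> {(u, w), (w, u)}\<rparr>"
  shows "undirected_tree T'"
proof -
  from T interpret T: pair_graph T by (simp add: undirected_tree_def)
  have sym: "sym (parcs T)" using T.sym_arcs by (simp add: symmetric_def)
  interpret T': pair_graph T'
  proof unfold_locales
    have "sym (parcs T')" using sym by (auto simp: T'_def sym_def)
    then show "symmetric (with_proj T')" by (simp add: symmetric_def)
  qed (use T.in_arcsD1 T.in_arcsD2 T.no_loops' T.finite_verts T.finite_arcs u w
      in \<open>auto simp: T'_def\<close>)
  have conn: "pverts T \<times> pverts T \<subseteq> (parcs T)\<^sup>*"
    using T connected_with_proj[OF T.pair_graph] by (simp add: undirected_tree_def)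
  have "(parcs T)\<^sup>* \<subseteq> (parcs T')\<^sup>*" by (rule rtrancl_mono) (auto simp: T'_def)
  then have to_u: "(x, u) \<in> (parcs T')\<^sup>*" and from_u: "(u, x) \<in> (parcs T')\<^sup>*"
    if "x \<in> pverts T'" for x
    using conn u that by (auto simp: T'_def)
  have "connected (with_proj T')"
    unfolding connected_with_proj[OF T'.pair_graph]
    using to_u from_u by (auto simp: T'_def intro: rtrancl_trans)
  moreover have False if cyc: "T'.cycle p" and len: "3 \<le> length p" for p
  proof -
    from cyc obtain v where p: "T'.awalk v p v" "distinct (tl (pawalk_verts v p))"
      unfolding T'.cycle_def by auto
    have ne: "p \<noteq> []" using len by auto
    have cas: "pcas v p v" and arcs: "set p \<subseteq> parcs T'"
      using p(1) by (auto simp: T'.awalk_def)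
    have verts: "pawalk_verts v p = fst (hd p) # map snd p"
      using T'.awalk_verts_conv'[OF cas] ne by simp
    \<comment> \<open>\<open>tl\<close> drops only the start vertex, which leaves the heads of the
      arcs.\<close>
    then have dist: "distinct (map snd p)" using p(2) by simp
    show False
    proof (cases "w \<in> snd ` set p")
      case True
      obtain a b where ab: "(a, w) \<in> set p" "(w, b) \<in> set p" "a \<noteq> b"
        using closed_walk_neighbors[OF cas dist len True] .
      then have "(a, w) \<in> parcs T'" "(w, b) \<in> parcs T'" using arcs by auto
      then have "a = u" "b = u"
        using w T.in_arcsD1 T.in_arcsD2 by (auto simp: T'_def)
      with ab show False by simp
    next
      case False
      \<comment> \<open>The walk is closed, so its start \<open>v\<close> is also a head. Hence
        \<open>w\<close>, not being a head, is not a tail either.\<close>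
      have "snd (last p) \<in> snd ` set p" "v = snd (last p)"
        using ne pcas_nth(2)[OF cas ne] by (auto simp: last_conv_nth)
      then have vw: "v \<noteq> w" using False by auto
      have "fst e \<noteq> w" if "e \<in> set p" for e
      proof -
        from that obtain i where i: "i < length p" "p ! i = e" by (auto simp: in_set_conv_nth)
        show ?thesis
        proof (cases i)
          case 0
          then show ?thesis using pcas_nth(1)[OF cas ne] i vw by simp
        next
          case (Suc j)
          then have "fst e = snd (p ! j)" "p ! j \<in> set p"
            using pcas_nth(3)[OF cas ne, of j] i by auto
          then show ?thesis using False by auto
        qed
      qed
      then have sub: "set p \<subseteq> parcs T"
        using arcs False by (force simp: T'_def)
      moreover have hd: "fst (hd p) = v"
        using pcas_nth(1)[OF cas ne] ne by (simp add: hd_conv_nth)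
      ultimately have "T.awalk v p v"
        using cas hd hd_in_set[OF ne] T.arc_fst_in_verts by (auto simp: T.awalk_def)
      then have "T.cycle p" using p ne unfolding T.cycle_def by auto
      with T len show False by (auto simp: undirected_tree_def)
    qed
  qed
  ultimately show ?thesis
    unfolding undirected_tree_def using T'.pair_graph by blast
qed

lemma exists_tree_in_component:
  assumes fin: "finite (R\<^sup>* `` {a})" and sym: "sym R" and k: "0 < k" "k \<le> card (R\<^sup>* `` {a})"
  shows "\<exists>T. undirected_tree T \<and> a \<in> pverts T \<and> pverts T \<subseteq> R\<^sup>* `` {a} \<and> parcs T \<subseteq> R \<and>
    card (pverts T) = k"
  using k
proof (induction k rule: nat_induct_non_zero)
  case 1
  show ?case
    by (rule exI[of _ "\<lparr>pverts = {a}, parcs = {}\<rparr>"]) (simp add: undirected_tree_single)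
next
  case (Suc k)
  then obtain T where T: "undirected_tree T" "a \<in> pverts T" "pverts T \<subseteq> R\<^sup>* `` {a}"
    "parcs T \<subseteq> R" "card (pverts T) = k"
    by auto
  have "\<not> R\<^sup>* `` {a} \<subseteq> pverts T"
    using T Suc.prems by (metis Suc_n_not_le_n subset_antisym)
  \<comment> \<open>A vertex set that contains \<open>a\<close> and is closed under \<open>R\<close>
    contains the whole component. As \<open>T\<close> is too small for that, some arc leaves
    it.\<close>
  moreover have "R\<^sup>* `` {a} \<subseteq> pverts T" if "R `` pverts T \<subseteq> pverts T"
    using Image_closed_trancl[OF that] T(2) by blast
  ultimately obtain u w where uw: "u \<in> pverts T" "(u, w) \<in> R" "w \<notin> pverts T"
    by blast
  let ?T' = "\<lparr>pverts = insert w (pverts T), parcs = parcs T \<union> {(u, w), (w, u)}\<rparr>"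
  have "undirected_tree ?T'" by (rule undirected_tree_insert_leaf[OF T(1) uw(1,3)])
  moreover have "w \<in> R\<^sup>* `` {a}" using T(3) uw by (auto intro: rtrancl_into_rtrancl)
  moreover have "(w, u) \<in> R" using uw sym by (auto dest: symD)
  moreover have "finite (pverts T)" using T(3) fin finite_subset by blast
  ultimately show ?case using T uw by (intro exI[of _ ?T']) auto
qed

section \<open>Monochromatic components\<close>

lemma sym_rtrancl_Image_eq:
  assumes "sym R" "(u, v) \<in> R"
  shows "R\<^sup>* `` {u} = R\<^sup>* `` {v}"
  using assms by (auto dest: symD intro: converse_rtrancl_into_rtrancl)

theorem theorem1:
  fixes G :: "'a pair_pre_digraph" and n :: nat
  assumes "pair_graph G"
    and "0 < n"
    and "chromatic_number G = n"
  shows "\<forall>c. edge_coloring G 2 c \<longrightarrow>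
    (\<exists>T. undirected_tree T \<and> subgraph (with_proj T) (with_proj G) \<and>
         card (pverts T) = n \<and> monochromatic c T)"
proof (intro allI impI)
  fix c assume c: "edge_coloring G 2 c"
  interpret G: pair_graph G by fact
  define R where "R i = {(u, v) \<in> parcs G. c {u, v} = i}" for i :: nat
  \<comment> \<open>Reflexivity turns a vertex without edges of color \<open>i\<close> into a
    singleton component, so every vertex has an end on both sides of the multigraph.\<close>
  define K where "K i v = (R i)\<^sup>* `` {v}" for i v
  have sym: "sym (R i)" for i
    using G.arcs_symmetric by (auto simp: sym_def R_def insert_commute)
  have K_verts: "K i v \<subseteq> pverts G" if "v \<in> pverts G" for i v
  proof
    fix w assume "w \<in> K i v"
    then have "(v, w) \<in> (R i)\<^sup>*" by (simp add: K_def)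
    then show "w \<in> pverts G"
      using that by induction (auto simp: R_def dest: G.in_arcsD2)
  qed
  have fin: "finite (K i v)" if "v \<in> pverts G" for i v
    using K_verts[OF that] G.finite_verts finite_subset by blast
  have "\<exists>i. \<exists>v\<in>pverts G. n \<le> card (K i v)"
  proof (rule ccontr)
    assume "\<not> ?thesis"
    then have "card (K i v) < n" if "v \<in> pverts G" for i v
      using that by (meson not_le)
    then have small: "card (K i v) \<le> n - 1" if "v \<in> pverts G" for i v
      using that assms(2) by (metis Suc_pred' less_Suc_eq_le)
    \<comment> \<open>The vertices with component \<open>X\<close> all lie in \<open>X\<close>, so
      the degree of the node \<open>X\<close> is at most its size; a set \<open>X\<close> that is no
      component has degree 0.\<close>
    have deg: "card {v \<in> pverts G. K i v = X} \<le> n - 1" for i X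
    proof (cases "\<exists>v\<in>pverts G. K i v = X")
      case True
      then obtain v where v: "v \<in> pverts G" "K i v = X" by blast
      have "{v \<in> pverts G. K i v = X} \<subseteq> X" by (auto simp: K_def)
      then have "card {v \<in> pverts G. K i v = X} \<le> card X"
        using fin[OF v(1), of i] v(2) by (intro card_mono) auto
      then show ?thesis using small[OF v(1), of i] v(2) by simp
    next
      case False
      then have "{v \<in> pverts G. K i v = X} = {}" by blast
      then show ?thesis by (metis card.empty zero_le)
    qed
    obtain f where f: "konig_coloring (pverts G) (K 0) (K 1) (n - 1) f"
      using konig_edge_coloring[OF G.finite_verts deg deg] by blast
    have "f u \<noteq> f v" if uv: "(u, v) \<in> parcs G" for u v
    proof -
      have "{u, v} \<in> uedges G" using uv by (force simp: uedges_def)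
      then have "c {u, v} < 2" using c by (auto simp: edge_coloring_def)
      then have "(u, v) \<in> R 0 \<or> (u, v) \<in> R 1" using uv by (auto simp: R_def)
      then have "K 0 u = K 0 v \<or> K 1 u = K 1 v"
        unfolding K_def using sym_rtrancl_Image_eq[OF sym] by blast
      then show ?thesis
        using f G.in_arcsD1[OF uv] G.in_arcsD2[OF uv] G.no_loops'[OF uv]
        unfolding konig_coloring_def by blast
    qed
    then have "proper_coloring G (n - 1) f"
      using f by (auto simp: proper_coloring_def konig_coloring_def)
    then have "chromatic_number G \<le> n - 1"
      unfolding chromatic_number_def by (intro Least_le exI)
    \<comment> \<open>Subtraction truncates at 0, so \<open>0 < n\<close> is needed to refute
      \<open>n \<le> n - 1\<close>.\<close>
    with assms show False by simp
  qed
  then obtain i v where v: "v \<in> pverts G" "n \<le> card (K i v)" by blast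
  obtain T where T: "undirected_tree T" "pverts T \<subseteq> K i v" "parcs T \<subseteq> R i"
    "card (pverts T) = n"
    using exists_tree_in_component[OF fin[OF v(1), unfolded K_def] sym assms(2)
        v(2)[unfolded K_def]]
    unfolding K_def by blast
  interpret T: pair_graph T using T(1) by (simp add: undirected_tree_def)
  have "subgraph (with_proj T) (with_proj G)"
    using T(2,3) K_verts[OF v(1), of i] T.wf_digraph_axioms G.wf_digraph_axioms
    by (auto simp: subgraph_def R_def)
  moreover have "monochromatic c T"
    using T(3) by (auto simp: monochromatic_def uedges_def R_def intro!: exI[of _ i])
  ultimately show "\<exists>T. undirected_tree T \<and> subgraph (with_proj T) (with_proj G) \<and>
         card (pverts T) = n \<and> monochromatic c T"
    using T by blast
qed

end
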